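(* Let $p$ be a prime and let $\mathcal{F}=\{F_1,\dots,F_n\}$ with $F_i(x)=(-1)^{b_i}p^{k_i}x+d_i$, where $b_i\in\{0,1\}$, $k_i\in\mathbb{Z}$, $k_i\ge 1$ and $d_i\in\mathbb{Z}_p\cap\mathbb{Q}$, and let $K$ be its $p$-adic self-similar set. Then there exists a linear map $L$ such that for each $i$, $L\circ F_i\circ L^{-1}(x)=(-1)^{b_i}p^{k_i}x+d_i'$ where (1) $d_i'\in\mathbb{Z}_p\cap\mathbb{Z}$ for all $i$; (2) if $b_i=0$ then $d_i'\ge0$, and if $b_i=1$ then $d_i'\le 0$; (3) there exists an $i$ with $d_i'=0$. Moreover, the attractor of $\{L\circ F_i\circ L^{-1}\}$ is $L(K)$, and $\dim_{H}(K)=\dim_{H}(L(K))$.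
   Context: Here "linear map" means a map $\mathbb{Q}_p\to\mathbb{Q}_p$ of the form $x\mapsto cx+a$ with $c\neq0$ (as in the paper, where contractions $x\mapsto ax+d$ are called linear). The $p$-adic self-similar set (attractor) of a family of contractions $\{G_i\}$ is the unique non-empty compact set $K$ with $K=\bigcup_iG_i(K)$. Hausdorff dimension is with respect to the $p$-adic metric $|x-y|_p$. *)

theory Defs
  imports "HOL-Analysis.Analysis" "HOL-Computational_Algebra.Primes"
begin

section \<open>The \<open>p\<close>-adic absolute value on the rationals\<close>

definition padic_abs :: "nat \<Rightarrow> rat \<Rightarrow> real" where
  "padic_abs p x = (if x = 0 then 0 else
     (let (a, b) = quotient_of x in
        real p powi (int (multiplicity (int p) b) - int (multiplicity (int p) a))))"

lemma padic_abs_0 [simp]: "padic_abs p 0 = 0"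
  by (simp add: padic_abs_def)

lemma padic_abs_divide:
  assumes "prime p" "a \<noteq> 0" "b \<noteq> 0"
  shows "padic_abs p (of_int a / of_int b) =
           real p powi (int (multiplicity (int p) b) - int (multiplicity (int p) a))"
proof -
  obtain c d where cd: "quotient_of (of_int a / of_int b) = (c, d)"
    by fastforce
  have x: "(of_int a / of_int b :: rat) = of_int c / of_int d" and "d > 0"
    using quotient_of_div[OF cd] quotient_of_denom_pos[OF cd] by auto
  have "c \<noteq> 0"
    using x assms by auto
  have "(of_int (a * d) :: rat) = of_int (c * b)"
    using x assms \<open>d > 0\<close> by (simp add: field_simps)
  hence eq: "a * d = c * b"
    by (simp only: of_int_eq_iff)
  have "prime_elem (int p)"
    using assms(1) by (simp add: prime_imp_prime_elem)
  hence "multiplicity (int p) a + multiplicity (int p) d =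
         multiplicity (int p) c + multiplicity (int p) b"
    using assms \<open>d > 0\<close> \<open>c \<noteq> 0\<close> arg_cong[OF eq, of "multiplicity (int p)"]
    by (simp add: prime_elem_multiplicity_mult_distrib)
  hence "int (multiplicity (int p) d) - int (multiplicity (int p) c) =
         int (multiplicity (int p) b) - int (multiplicity (int p) a)"
    by linarith
  thus ?thesis
    using assms cd by (simp add: padic_abs_def)
qed

lemma rat_cases_int:
  obtains a b :: int where "x = (of_int a / of_int b :: rat)" "b \<noteq> 0"
proof -
  obtain a b where ab: "quotient_of x = (a, b)" by fastforce
  show ?thesis
    using that[OF quotient_of_div[OF ab]] quotient_of_denom_pos[OF ab] by simp
qed

lemma padic_abs_nonneg [simp]: "padic_abs p x \<ge> 0"
  by (auto simp: padic_abs_def Let_def split: prod.splits)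

lemma padic_abs_eq_0_iff [simp]: "prime p \<Longrightarrow> padic_abs p x = 0 \<longleftrightarrow> x = 0"
  by (auto simp: padic_abs_def Let_def prime_gt_0_nat split: prod.splits)

lemma padic_abs_1 [simp]: "prime p \<Longrightarrow> padic_abs p 1 = 1"
  using padic_abs_divide[of p 1 1] by simp

lemma padic_abs_minus [simp]: "padic_abs p (- x) = padic_abs p x"
proof -
  have "multiplicity (int p) (- a) = multiplicity (int p) a" for a
    using multiplicity_times_unit_right[of "-1" "int p" a] by simp
  thus ?thesis
    by (auto simp: padic_abs_def rat_uminus_code Let_def split: prod.splits)
qed

lemma padic_abs_minus_commute: "padic_abs p (x - y) = padic_abs p (y - x)"
  using padic_abs_minus[of p "x - y"] by simp

lemma padic_abs_mult:
  assumes "prime p"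
  shows "padic_abs p (x * y) = padic_abs p x * padic_abs p y"
proof (cases "x = 0 \<or> y = 0")
  case False
  obtain a b where x: "x = of_int a / of_int b" "b \<noteq> 0" by (rule rat_cases_int)
  obtain c d where y: "y = of_int c / of_int d" "d \<noteq> 0" by (rule rat_cases_int)
  have nz: "a \<noteq> 0" "c \<noteq> 0" using False x y by auto
  have "prime_elem (int p)" using assms by (simp add: prime_imp_prime_elem)
  hence "padic_abs p (of_int (a * c) / of_int (b * d)) =
          padic_abs p (of_int a / of_int b) * padic_abs p (of_int c / of_int d)"
    using assms x y nz prime_gt_0_nat[OF assms]
    by (subst (1 2 3) padic_abs_divide)
       (auto simp: prime_elem_multiplicity_mult_distrib power_int_add [symmetric] algebra_simps)
  thus ?thesis using x y by simp
qed auto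

lemma padic_abs_inverse:
  assumes "prime p"
  shows "padic_abs p (inverse x) = inverse (padic_abs p x)"
proof (cases "x = 0")
  case False
  have "padic_abs p (inverse x) * padic_abs p x = 1"
    using False assms by (simp flip: padic_abs_mult)
  thus ?thesis
    using inverse_unique mult.commute by metis
qed auto

lemma padic_abs_of_int_le_1:
  assumes "prime p"
  shows "padic_abs p (of_int a) \<le> 1"
proof (cases "a = 0")
  case False
  have "padic_abs p (of_int a) = real p powi (- int (multiplicity (int p) a))"
    using padic_abs_divide[OF assms False, of 1] by simp
  also have "\<dots> \<le> 1"
    using prime_gt_0_nat[OF assms] by (auto simp: power_int_minus intro!: inverse_le_1_iff[THEN iffD2])
  finally show ?thesis .
qed auto

lemma padic_abs_add_le_max:
  assumes "prime p"
  shows "padic_abs p (x + y) \<le> max (padic_abs p x) (padic_abs p y)"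
proof -
  have *: "padic_abs p (1 + z) \<le> 1" if z: "padic_abs p z \<le> 1" for z
  proof (cases "z = 0")
    case False
    obtain a b where ab: "quotient_of z = (a, b)" by fastforce
    have zab: "z = of_int a / of_int b" and b: "b > 0" and "coprime a b"
      using quotient_of_div[OF ab] quotient_of_denom_pos[OF ab] quotient_of_coprime[OF ab] by auto
    have p1: "real p > 1" using prime_gt_1_nat[OF assms] by simp
    have "real p powi (int (multiplicity (int p) b) - int (multiplicity (int p) a)) \<le> real p powi 0"
      using z False ab by (simp add: padic_abs_def)
    hence "int (multiplicity (int p) b) - int (multiplicity (int p) a) \<le> 0"
      by (rule power_int_le_imp_le_exp[OF p1]) simp
    hence le: "multiplicity (int p) b \<le> multiplicity (int p) a"
      by simp
    have "multiplicity (int p) b = 0"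
    proof (rule ccontr)
      assume "multiplicity (int p) b \<noteq> 0"
      hence "multiplicity (int p) a \<noteq> 0"
        using le by linarith
      hence "int p dvd b" "int p dvd a"
        using \<open>multiplicity (int p) b \<noteq> 0\<close> not_dvd_imp_multiplicity_0[of "int p" a]
          not_dvd_imp_multiplicity_0[of "int p" b] by linarith+
      with \<open>coprime a b\<close> have "is_unit (int p)"
        using coprime_common_divisor[of a b "int p"] by blast
      hence "p = 1" by simp
      thus False using assms by simp
    qed
    have "1 + z = of_int (a + b) * inverse (of_int b)"
      using zab b by (simp add: field_simps)
    hence "padic_abs p (1 + z) = padic_abs p (of_int (a + b)) * inverse (padic_abs p (of_int b))"
      by (simp only: padic_abs_mult[OF assms] padic_abs_inverse[OF assms])
    moreover have "padic_abs p (of_int b) = 1"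
      using padic_abs_divide[OF assms, of b 1] b \<open>multiplicity (int p) b = 0\<close> by simp
    ultimately show ?thesis
      using padic_abs_of_int_le_1[OF assms, of "a + b"] by simp
  qed (use assms in auto)
  have **: "padic_abs p (x + y) \<le> padic_abs p x" if "padic_abs p y \<le> padic_abs p x" for x y
  proof (cases "x = 0")
    case False
    hence pos: "padic_abs p x > 0"
      using padic_abs_nonneg[of p x] padic_abs_eq_0_iff[OF assms, of x] by linarith
    have "padic_abs p (y / x) \<le> 1"
      using that pos
      by (simp only: divide_inverse padic_abs_mult[OF assms] padic_abs_inverse[OF assms])
         (simp add: field_simps)
    hence "padic_abs p (1 + y / x) \<le> 1" by (rule *)
    moreover have "x + y = x * (1 + y / x)" using False by (simp add: field_simps)
    ultimately show ?thesis
      using pos by (simp add: padic_abs_mult[OF assms])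
  qed (use that assms padic_abs_nonneg[of p y] in auto)
  show ?thesis
  proof (cases "padic_abs p y \<le> padic_abs p x")
    case True
    thus ?thesis using **[OF True] by (simp add: max_def)
  next
    case False
    thus ?thesis using **[of x y] by (simp add: max_def add.commute[of x])
  qed
qed

lemma padic_abs_triangle:
  assumes "prime p"
  shows "padic_abs p (x + y) \<le> padic_abs p x + padic_abs p y"
  using padic_abs_add_le_max[OF assms, of x y] padic_abs_nonneg[of p x] padic_abs_nonneg[of p y]
  by linarith

lemma padic_abs_diff_triangle:
  assumes "prime p"
  shows "\<bar>padic_abs p x - padic_abs p y\<bar> \<le> padic_abs p (x - y)"
  using padic_abs_triangle[OF assms, of "x - y" y] padic_abs_triangle[OF assms, of "y - x" x]
    padic_abs_minus_commute[of p x y] by simp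


section \<open>Cauchy sequences of rationals for the \<open>p\<close>-adic absolute value\<close>

definition padic_null :: "nat \<Rightarrow> (nat \<Rightarrow> rat) \<Rightarrow> bool" where
  "padic_null p X \<longleftrightarrow> (\<lambda>n. padic_abs p (X n)) \<longlonglongrightarrow> 0"

definition padic_Cauchy :: "nat \<Rightarrow> (nat \<Rightarrow> rat) \<Rightarrow> bool" where
  "padic_Cauchy p X \<longleftrightarrow> (\<forall>e>0. \<exists>N. \<forall>m\<ge>N. \<forall>n\<ge>N. padic_abs p (X m - X n) < e)"

lemma padic_null_le:
  assumes "padic_null p X" "\<And>n. n \<ge> N \<Longrightarrow> padic_abs p (Y n) \<le> C * padic_abs p (X n)"
  shows "padic_null p Y"
  unfolding padic_null_def
proof (rule tendsto_sandwich[where f = "\<lambda>_. 0"])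
  show "(\<lambda>n. C * padic_abs p (X n)) \<longlonglongrightarrow> 0"
    using assms(1) unfolding padic_null_def by (rule tendsto_mult_right_zero)
  show "\<forall>\<^sub>F n in sequentially. padic_abs p (Y n) \<le> C * padic_abs p (X n)"
    using assms(2) by (auto simp: eventually_sequentially)
qed auto

lemma padic_null_0 [simp]: "padic_null p (\<lambda>n. 0)"
  by (simp add: padic_null_def)

lemma padic_null_minus [simp]: "padic_null p (\<lambda>n. - X n) \<longleftrightarrow> padic_null p X"
  by (simp add: padic_null_def)

lemma padic_null_add:
  assumes "prime p" "padic_null p X" "padic_null p Y"
  shows "padic_null p (\<lambda>n. X n + Y n)"
  unfolding padic_null_def
proof (rule tendsto_sandwich[where f = "\<lambda>_. 0"])
  show "(\<lambda>n. padic_abs p (X n) + padic_abs p (Y n)) \<longlonglongrightarrow> 0"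
    using tendsto_add[OF assms(2,3)[unfolded padic_null_def]] by simp
qed (auto simp: padic_abs_triangle assms)

lemma padic_null_diff:
  assumes "prime p" "padic_null p X" "padic_null p Y"
  shows "padic_null p (\<lambda>n. X n - Y n)"
  using padic_null_add[of p X "\<lambda>n. - Y n"] assms by simp

lemma padic_null_mult:
  assumes "prime p" "padic_null p X" "\<And>n. padic_abs p (Y n) \<le> B"
  shows "padic_null p (\<lambda>n. X n * Y n)"
  by (rule padic_null_le[OF assms(2), of 0 _ B])
     (auto simp: padic_abs_mult assms mult.commute[of B] intro!: mult_left_mono)

lemma padic_Cauchy_const [simp]: "padic_Cauchy p (\<lambda>n. c)"
  by (simp add: padic_Cauchy_def)

lemma padic_Cauchy_le:
  assumes "padic_Cauchy p X" "padic_Cauchy p Y" "C > 0"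
    and "\<And>m n. m \<ge> N \<Longrightarrow> n \<ge> N \<Longrightarrow>
           padic_abs p (Z m - Z n) \<le> C * (padic_abs p (X m - X n) + padic_abs p (Y m - Y n))"
  shows "padic_Cauchy p Z"
  unfolding padic_Cauchy_def
proof (intro allI impI)
  fix e :: real assume "e > 0"
  hence e: "e / (2 * C) > 0" using assms(3) by simp
  obtain N1 where N1: "\<And>m n. m \<ge> N1 \<Longrightarrow> n \<ge> N1 \<Longrightarrow> padic_abs p (X m - X n) < e / (2 * C)"
    using assms(1) e unfolding padic_Cauchy_def by blast
  obtain N2 where N2: "\<And>m n. m \<ge> N2 \<Longrightarrow> n \<ge> N2 \<Longrightarrow> padic_abs p (Y m - Y n) < e / (2 * C)"
    using assms(2) e unfolding padic_Cauchy_def by blast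
  have "padic_abs p (Z m - Z n) < e"
    if "m \<ge> max N (max N1 N2)" "n \<ge> max N (max N1 N2)" for m n
  proof -
    have "padic_abs p (Z m - Z n) \<le> C * (padic_abs p (X m - X n) + padic_abs p (Y m - Y n))"
      using that assms(4) by simp
    also have "\<dots> < C * (e / (2 * C) + e / (2 * C))"
      using that assms(3) by (intro mult_strict_left_mono add_strict_mono N1 N2) auto
    also have "\<dots> = e" using assms(3) by (simp add: field_simps)
    finally show ?thesis .
  qed
  thus "\<exists>N. \<forall>m\<ge>N. \<forall>n\<ge>N. padic_abs p (Z m - Z n) < e" by blast
qed

lemma padic_Cauchy_minus:
  "padic_Cauchy p X \<Longrightarrow> padic_Cauchy p (\<lambda>n. - X n)"
  by (rule padic_Cauchy_le[of p X X 1 0])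
     (auto simp: padic_abs_minus_commute)

lemma padic_Cauchy_add:
  assumes "prime p" "padic_Cauchy p X" "padic_Cauchy p Y"
  shows "padic_Cauchy p (\<lambda>n. X n + Y n)"
proof (rule padic_Cauchy_le[OF assms(2,3), of 1 0])
  fix m n
  show "padic_abs p (X m + Y m - (X n + Y n)) \<le>
          1 * (padic_abs p (X m - X n) + padic_abs p (Y m - Y n))"
    using padic_abs_triangle[OF assms(1), of "X m - X n" "Y m - Y n"]
    by (simp add: algebra_simps)
qed auto

lemma padic_Cauchy_abs_convergent:
  assumes "prime p" "padic_Cauchy p X"
  shows "convergent (\<lambda>n. padic_abs p (X n))"
proof (rule Cauchy_convergent, rule metric_CauchyI)
  fix e :: real assume "e > 0"
  then obtain N where "\<And>m n. m \<ge> N \<Longrightarrow> n \<ge> N \<Longrightarrow> padic_abs p (X m - X n) < e"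
    using assms(2) unfolding padic_Cauchy_def by blast
  thus "\<exists>M. \<forall>m\<ge>M. \<forall>n\<ge>M. dist (padic_abs p (X m)) (padic_abs p (X n)) < e"
    using padic_abs_diff_triangle[OF assms(1)] unfolding dist_real_def
    by (meson le_less_trans)
qed

lemma padic_Cauchy_bounded:
  assumes "prime p" "padic_Cauchy p X"
  obtains B where "B > 0" "\<And>n. padic_abs p (X n) \<le> B"
proof -
  have "Bseq (\<lambda>n. padic_abs p (X n))"
    using padic_Cauchy_abs_convergent[OF assms] by (rule convergent_imp_Bseq)
  thus ?thesis using that by (auto elim!: BseqE)
qed

lemma padic_Cauchy_mult:
  assumes "prime p" "padic_Cauchy p X" "padic_Cauchy p Y"
  shows "padic_Cauchy p (\<lambda>n. X n * Y n)"
proof -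
  obtain A where A: "A > 0" "\<And>n. padic_abs p (X n) \<le> A"
    using padic_Cauchy_bounded[OF assms(1,2)] by blast
  obtain B where B: "B > 0" "\<And>n. padic_abs p (Y n) \<le> B"
    using padic_Cauchy_bounded[OF assms(1,3)] by blast
  show ?thesis
  proof (rule padic_Cauchy_le[OF assms(2,3), of "A + B" 0])
    fix m n
    have "padic_abs p (X m * Y m - X n * Y n) =
            padic_abs p ((X m - X n) * Y m + X n * (Y m - Y n))"
      by (simp add: algebra_simps)
    also have "\<dots> \<le> padic_abs p (X m - X n) * padic_abs p (Y m) +
                     padic_abs p (X n) * padic_abs p (Y m - Y n)"
      by (metis padic_abs_triangle padic_abs_mult assms(1))
    also have "\<dots> \<le> padic_abs p (X m - X n) * (A + B) + (A + B) * padic_abs p (Y m - Y n)"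
      using A(1) B(1) A(2)[of n] B(2)[of m] by (intro add_mono mult_mono) auto
    finally show "padic_abs p (X m * Y m - X n * Y n) \<le>
                    (A + B) * (padic_abs p (X m - X n) + padic_abs p (Y m - Y n))"
      by (simp add: algebra_simps)
  qed (use A B in auto)
qed

lemma padic_Cauchy_not_null:
  assumes "prime p" "padic_Cauchy p X" "\<not> padic_null p X"
  obtains b N where "b > 0" "\<And>n. n \<ge> N \<Longrightarrow> padic_abs p (X n) > b"
proof -
  obtain l where l: "(\<lambda>n. padic_abs p (X n)) \<longlonglongrightarrow> l"
    using padic_Cauchy_abs_convergent[OF assms(1,2)] by (auto simp: convergent_def)
  have "l \<ge> 0" by (rule LIMSEQ_le_const[OF l]) auto
  moreover have "l \<noteq> 0" using l assms(3) by (auto simp: padic_null_def)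
  ultimately have "l / 2 > 0" "l / 2 < l" by auto
  with order_tendstoD(1)[OF l] show ?thesis
    using that unfolding eventually_sequentially by blast
qed

lemma padic_Cauchy_inverse:
  assumes "prime p" "padic_Cauchy p X" "\<not> padic_null p X"
  shows "padic_Cauchy p (\<lambda>n. inverse (X n))"
proof -
  obtain b N where b: "b > 0" "\<And>n. n \<ge> N \<Longrightarrow> padic_abs p (X n) > b"
    using padic_Cauchy_not_null[OF assms] by blast
  show ?thesis
  proof (rule padic_Cauchy_le[OF assms(2,2), of "inverse b * inverse b" N])
    fix m n assume mn: "m \<ge> N" "n \<ge> N"
    have nz: "X m \<noteq> 0" "X n \<noteq> 0" using b(1) b(2)[OF mn(1)] b(2)[OF mn(2)] by auto
    have "inverse (X m) - inverse (X n) = inverse (X m) * inverse (X n) * - (X m - X n)"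
      using nz by (simp add: field_simps)
    hence "padic_abs p (inverse (X m) - inverse (X n)) =
             inverse (padic_abs p (X m)) * inverse (padic_abs p (X n)) * padic_abs p (X m - X n)"
      by (simp only: padic_abs_mult[OF assms(1)] padic_abs_inverse[OF assms(1)] padic_abs_minus)
    also have "\<dots> \<le> inverse b * inverse b * (padic_abs p (X m - X n) + padic_abs p (X m - X n))"
      using b(1) b(2)[OF mn(1)] b(2)[OF mn(2)]
      by (intro mult_mono) (auto intro!: le_imp_inverse_le)
    finally show "padic_abs p (inverse (X m) - inverse (X n)) \<le>
      inverse b * inverse b * (padic_abs p (X m - X n) + padic_abs p (X m - X n))" .
  qed (use b in auto)
qed

lemma padic_null_diff_inverse:
  assumes "prime p" "padic_Cauchy p X" "\<not> padic_null p X" "padic_Cauchy p Y" "\<not> padic_null p Y"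
    and "padic_null p (\<lambda>n. X n - Y n)"
  shows "padic_null p (\<lambda>n. inverse (X n) - inverse (Y n))"
proof -
  obtain a M where a: "a > 0" "\<And>n. n \<ge> M \<Longrightarrow> padic_abs p (X n) > a"
    using padic_Cauchy_not_null[OF assms(1-3)] by blast
  obtain b N where b: "b > 0" "\<And>n. n \<ge> N \<Longrightarrow> padic_abs p (Y n) > b"
    using padic_Cauchy_not_null[OF assms(1,4,5)] by blast
  show ?thesis
  proof (rule padic_null_le[OF assms(6), of "max M N" _ "inverse a * inverse b"])
    fix n assume "n \<ge> max M N"
    hence gt: "padic_abs p (X n) > a" "padic_abs p (Y n) > b" using a b by auto
    hence nz: "X n \<noteq> 0" "Y n \<noteq> 0" using a(1) b(1) by auto
    have "inverse (X n) - inverse (Y n) = inverse (X n) * inverse (Y n) * - (X n - Y n)"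
      using nz by (simp add: field_simps)
    hence "padic_abs p (inverse (X n) - inverse (Y n)) =
             inverse (padic_abs p (X n)) * inverse (padic_abs p (Y n)) * padic_abs p (X n - Y n)"
      by (simp only: padic_abs_mult[OF assms(1)] padic_abs_inverse[OF assms(1)] padic_abs_minus)
    also have "\<dots> \<le> inverse a * inverse b * padic_abs p (X n - Y n)"
      using a(1) b(1) gt by (intro mult_mono) (auto intro!: le_imp_inverse_le)
    finally show "padic_abs p (inverse (X n) - inverse (Y n)) \<le>
                    inverse a * inverse b * padic_abs p (X n - Y n)" .
  qed
qed


section \<open>The field of \<open>p\<close>-adic numbers\<close>

text \<open>The prime \<open>p\<close> is the cardinality of the index type, as for the dimension of \<open>real ^ 'n\<close>.\<close>

class prime_card = finite +
  assumes prime_card [simp]: "prime (CARD('a))"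

instance bool :: prime_card
  by standard simp

definition padic_rel :: "'p::prime_card itself \<Rightarrow> (nat \<Rightarrow> rat) \<Rightarrow> (nat \<Rightarrow> rat) \<Rightarrow> bool" where
  "padic_rel _ X Y \<longleftrightarrow> padic_Cauchy CARD('p) X \<and> padic_Cauchy CARD('p) Y \<and>
     padic_null CARD('p) (\<lambda>n. X n - Y n)"

lemma part_equivp_padic_rel: "part_equivp (padic_rel TYPE('p::prime_card))"
proof (rule part_equivpI)
  show "\<exists>X. padic_rel TYPE('p) X X"
    by (rule exI[of _ "\<lambda>_. 0"]) (simp add: padic_rel_def)
  show "symp (padic_rel TYPE('p))"
  proof (rule sympI)
    fix X Y assume "padic_rel TYPE('p) X Y"
    thus "padic_rel TYPE('p) Y X"
      using padic_null_minus[of "CARD('p)" "\<lambda>n. X n - Y n"]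
      unfolding padic_rel_def minus_diff_eq by blast
  qed
  show "transp (padic_rel TYPE('p))"
  proof (rule transpI)
    fix X Y Z assume "padic_rel TYPE('p) X Y" "padic_rel TYPE('p) Y Z"
    thus "padic_rel TYPE('p) X Z"
      using padic_null_add[OF prime_card, of "\<lambda>n. X n - Y n" "\<lambda>n. Y n - Z n"]
      unfolding padic_rel_def diff_add_cancel add_diff_eq by blast
  qed
qed

text \<open>
  This is what the command for quotient types does, which however does not accept the sort
  constraint on the type parameter.
\<close>

typedef ('p::prime_card) padic =
    "{C. \<exists>X. padic_rel TYPE('p) X X \<and> C = Collect (padic_rel TYPE('p) X)}"
  morphisms class_of_padic padic_of_class
proof -
  have "padic_rel TYPE('p) (\<lambda>_. 0) (\<lambda>_. 0)" by (simp add: padic_rel_def)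
  thus ?thesis by blast
qed

interpretation padic: quot_type "padic_rel TYPE('p::prime_card)"
    "padic_of_class :: _ \<Rightarrow> 'p padic" class_of_padic
proof (rule quot_type.intro[OF part_equivp_padic_rel])
  fix x y :: "'p padic" and C :: "(nat \<Rightarrow> rat) set"
  show "\<exists>X. padic_rel TYPE('p) X X \<and> class_of_padic x = Collect (padic_rel TYPE('p) X)"
    using class_of_padic[of x] by simp
  show "padic_of_class (class_of_padic x) = x"
    by (rule class_of_padic_inverse)
  show "class_of_padic (padic_of_class C :: 'p padic) = C"
    if "\<exists>X. padic_rel TYPE('p) X X \<and> C = Collect (padic_rel TYPE('p) X)"
    using that by (intro padic_of_class_inverse) simp
  show "class_of_padic x = class_of_padic y \<longleftrightarrow> x = y"
    by (rule class_of_padic_inject)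
qed

definition abs_padic :: "(nat \<Rightarrow> rat) \<Rightarrow> 'p::prime_card padic" where
  "abs_padic = quot_type.abs (padic_rel TYPE('p)) padic_of_class"

definition rep_padic :: "'p::prime_card padic \<Rightarrow> nat \<Rightarrow> rat" where
  "rep_padic = quot_type.rep class_of_padic"

definition cr_padic :: "(nat \<Rightarrow> rat) \<Rightarrow> 'p::prime_card padic \<Rightarrow> bool" where
  "cr_padic = (\<lambda>X x. padic_rel TYPE('p) X X \<and> abs_padic X = x)"

lemma Quotient_padic:
  "Quotient (padic_rel TYPE('p::prime_card)) (abs_padic :: _ \<Rightarrow> 'p padic) rep_padic cr_padic"
proof (rule Quotient3_to_Quotient)
  show "Quotient3 (padic_rel TYPE('p)) (abs_padic :: _ \<Rightarrow> 'p padic) rep_padic"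
    unfolding abs_padic_def rep_padic_def by (rule padic.Quotient)
  show "(cr_padic :: _ \<Rightarrow> 'p padic \<Rightarrow> _) \<equiv>
          (\<lambda>X x. padic_rel TYPE('p) X X \<and> abs_padic X = x)"
    by (rule eq_reflection) (rule cr_padic_def)
qed

setup_lifting Quotient_padic

instantiation padic :: (prime_card) field
begin

lift_definition zero_padic :: "'a padic" is "\<lambda>n. 0"
  by (simp add: padic_rel_def)

lift_definition one_padic :: "'a padic" is "\<lambda>n. 1"
  by (simp add: padic_rel_def)

lift_definition plus_padic :: "'a padic \<Rightarrow> 'a padic \<Rightarrow> 'a padic" is "\<lambda>X Y n. X n + Y n"
  unfolding padic_rel_def add_diff_add
  by (auto intro!: padic_Cauchy_add padic_null_add)

lift_definition uminus_padic :: "'a padic \<Rightarrow> 'a padic" is "\<lambda>X n. - X n"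
  unfolding padic_rel_def minus_diff_minus
  by (simp only: padic_Cauchy_minus padic_null_minus simp_thms)

lift_definition times_padic :: "'a padic \<Rightarrow> 'a padic \<Rightarrow> 'a padic" is "\<lambda>X Y n. X n * Y n"
proof -
  fix X X' Y Y' assume *: "padic_rel TYPE('a) X X'" "padic_rel TYPE('a) Y Y'"
  obtain A where A: "\<And>n. padic_abs CARD('a) (X n) \<le> A"
    using * padic_Cauchy_bounded[of "CARD('a)" X] by (auto simp: padic_rel_def)
  obtain B where B: "\<And>n. padic_abs CARD('a) (Y' n) \<le> B"
    using * padic_Cauchy_bounded[of "CARD('a)" Y'] by (auto simp: padic_rel_def)
  have "padic_null CARD('a) (\<lambda>n. (Y n - Y' n) * X n + (X n - X' n) * Y' n)"
    using * A B by (intro padic_null_add padic_null_mult[of _ _ _ A] padic_null_mult[of _ _ _ B])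
      (auto simp: padic_rel_def)
  thus "padic_rel TYPE('a) (\<lambda>n. X n * Y n) (\<lambda>n. X' n * Y' n)"
    using * by (auto simp: padic_rel_def algebra_simps intro!: padic_Cauchy_mult)
qed

lift_definition inverse_padic :: "'a padic \<Rightarrow> 'a padic"
  is "\<lambda>X. if padic_null CARD('a) X then (\<lambda>n. 0) else (\<lambda>n. inverse (X n))"
proof -
  fix X Y assume *: "padic_rel TYPE('a) X Y"
  have "padic_null CARD('a) X \<longleftrightarrow> padic_null CARD('a) Y"
    using padic_null_diff[of "CARD('a)" X "\<lambda>n. X n - Y n"]
      padic_null_add[of "CARD('a)" "\<lambda>n. X n - Y n" Y] * by (auto simp: padic_rel_def)
  thus "padic_rel TYPE('a) (if padic_null CARD('a) X then \<lambda>n. 0 else (\<lambda>n. inverse (X n)))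
          (if padic_null CARD('a) Y then \<lambda>n. 0 else (\<lambda>n. inverse (Y n)))"
    using * by (auto simp: padic_rel_def intro!: padic_Cauchy_inverse padic_null_diff_inverse)
qed

definition "x - y = x + - y" for x y :: "'a padic"

definition "x div y = x * inverse y" for x y :: "'a padic"

instance
proof
  fix a b c :: "'a padic"
  show "a + b = b + a"
    by transfer (auto simp: padic_rel_def ac_simps intro!: padic_Cauchy_add)
  show "(a + b) + c = a + (b + c)"
    by transfer (auto simp: padic_rel_def ac_simps intro!: padic_Cauchy_add)
  show "0 + a = a"
    by transfer (auto simp: padic_rel_def)
  show "- a + a = 0"
    by transfer (auto simp: padic_rel_def)
  show "a - b = a + - b"
    by (rule minus_padic_def)
  show "(a * b) * c = a * (b * c)"
    by transfer (auto simp: padic_rel_def ac_simps intro!: padic_Cauchy_mult)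
  show "a * b = b * a"
    by transfer (auto simp: padic_rel_def ac_simps intro!: padic_Cauchy_mult)
  show "1 * a = a"
    by transfer (auto simp: padic_rel_def)
  show "(a + b) * c = a * c + b * c"
    by transfer (auto simp: padic_rel_def algebra_simps intro!: padic_Cauchy_mult padic_Cauchy_add)
  show "(0::'a padic) \<noteq> 1"
    by transfer (auto simp: padic_rel_def padic_null_def LIMSEQ_const_iff)
  have "padic_null CARD('a) (\<lambda>n. inverse (X n) * X n - 1)"
    if X: "padic_Cauchy CARD('a) X" "\<not> padic_null CARD('a) X" for X
  proof -
    obtain b N where "b > 0" "\<And>n. n \<ge> N \<Longrightarrow> padic_abs CARD('a) (X n) > b"
      using padic_Cauchy_not_null[OF prime_card X] by blast
    hence "X n \<noteq> 0" if "n \<ge> N" for n using that by fastforce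
    thus ?thesis
      by (intro padic_null_le[OF padic_null_0, of N _ _ 0]) auto
  qed
  thus "a \<noteq> 0 \<Longrightarrow> inverse a * a = 1"
    by transfer
       (auto simp: padic_rel_def intro!: padic_Cauchy_mult padic_Cauchy_inverse)
  show "a div b = a * inverse b"
    by (rule divide_padic_def)
  show "inverse (0::'a padic) = 0"
    by transfer (auto simp: padic_rel_def)
qed

end


lemma cr_padic_eq: "pcr_padic = (\<lambda>X x. padic_Cauchy CARD('p) X \<and> abs_padic X = (x :: 'p::prime_card padic))"
  unfolding padic.pcr_cr_eq cr_padic_def padic_rel_def by simp

lemma abs_padic_cases [case_names abs, cases type: padic]:
  obtains X where "padic_Cauchy CARD('p) X" "x = (abs_padic X :: 'p::prime_card padic)"
  using Quotient_padic[where 'p = 'p] unfolding Quotient_def padic_rel_def by metis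

lemma abs_padic_eq_iff:
  assumes "padic_Cauchy CARD('p) X" "padic_Cauchy CARD('p) Y"
  shows "(abs_padic X :: 'p::prime_card padic) = abs_padic Y \<longleftrightarrow> padic_null CARD('p) (\<lambda>n. X n - Y n)"
  using assms padic.rel_eq_transfer[where 'p = 'p]
  unfolding cr_padic_eq rel_fun_def padic_rel_def by auto

lemma abs_padic_add:
  assumes "padic_Cauchy CARD('p) X" "padic_Cauchy CARD('p) Y"
  shows "abs_padic X + abs_padic Y = (abs_padic (\<lambda>n. X n + Y n) :: 'p::prime_card padic)"
  using assms plus_padic.transfer[where 'a = 'p] unfolding cr_padic_eq rel_fun_def by simp

lemma abs_padic_mult:
  assumes "padic_Cauchy CARD('p) X" "padic_Cauchy CARD('p) Y"
  shows "abs_padic X * abs_padic Y = (abs_padic (\<lambda>n. X n * Y n) :: 'p::prime_card padic)"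
  using assms times_padic.transfer[where 'a = 'p] unfolding cr_padic_eq rel_fun_def by simp

lemma of_nat_padic: "of_nat m = (abs_padic (\<lambda>_. of_nat m) :: 'p::prime_card padic)"
  by (induction m)
     (auto simp: zero_padic.abs_eq one_padic_def zero_padic_def abs_padic_add)

instance padic :: (prime_card) field_char_0
proof
  show "inj (of_nat :: nat \<Rightarrow> 'a padic)"
  proof (rule injI)
    fix m n :: nat assume "(of_nat m :: 'a padic) = of_nat n"
    hence "padic_null CARD('a) (\<lambda>_. of_nat m - of_nat n)"
      by (simp add: of_nat_padic abs_padic_eq_iff)
    thus "m = n" by (simp add: padic_null_def LIMSEQ_const_iff)
  qed
qed

lemma abs_padic_minus:
  assumes "padic_Cauchy CARD('p) X"
  shows "- abs_padic X = (abs_padic (\<lambda>n. - X n) :: 'p::prime_card padic)"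
  using assms uminus_padic.transfer[where 'a = 'p] unfolding cr_padic_eq rel_fun_def by simp

lemma of_int_padic: "of_int m = (abs_padic (\<lambda>_. of_int m) :: 'p::prime_card padic)"
  by (cases m rule: int_cases2) (auto simp: of_nat_padic abs_padic_minus)

lemma of_rat_padic: "of_rat r = (abs_padic (\<lambda>_. r) :: 'p::prime_card padic)"
proof -
  obtain a b where r: "r = of_int a / of_int b" "b \<noteq> 0" by (rule rat_cases_int)
  have "(abs_padic (\<lambda>_. r) :: 'p padic) * of_int b = of_int a"
    using r by (simp add: of_int_padic abs_padic_mult)
  hence "(abs_padic (\<lambda>_. r) :: 'p padic) = of_int a / of_int b"
    using r(2) by (simp add: nonzero_eq_divide_eq)
  thus ?thesis
    by (simp add: r(1) of_rat_divide)
qed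


section \<open>The \<open>p\<close>-adic metric\<close>

lift_definition padic_norm :: "'a::prime_card padic \<Rightarrow> real" is "\<lambda>X. lim (\<lambda>n. padic_abs CARD('a) (X n))"
proof -
  fix X Y assume *: "padic_rel TYPE('a) X Y"
  obtain l where l: "(\<lambda>n. padic_abs CARD('a) (Y n)) \<longlonglongrightarrow> l"
    using * padic_Cauchy_abs_convergent[of "CARD('a)" Y] by (auto simp: padic_rel_def convergent_def)
  have "(\<lambda>n. padic_abs CARD('a) (X n) - padic_abs CARD('a) (Y n)) \<longlonglongrightarrow> 0"
  proof (rule Lim_null_comparison)
    show "(\<lambda>n. padic_abs CARD('a) (X n - Y n)) \<longlonglongrightarrow> 0"
      using * by (simp add: padic_rel_def padic_null_def)
  qed (simp add: padic_abs_diff_triangle)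
  from tendsto_add[OF this l] have "(\<lambda>n. padic_abs CARD('a) (X n)) \<longlonglongrightarrow> l" by simp
  with l show "lim (\<lambda>n. padic_abs CARD('a) (X n)) = lim (\<lambda>n. padic_abs CARD('a) (Y n))"
    by (simp add: limI)
qed

lemma tendsto_norm_abs_padic:
  assumes "padic_Cauchy CARD('a) X"
  shows "(\<lambda>n. padic_abs CARD('a) (X n)) \<longlonglongrightarrow> padic_norm (abs_padic X :: 'a::prime_card padic)"
proof -
  have "padic_norm (abs_padic X :: 'a::prime_card padic) = lim (\<lambda>n. padic_abs CARD('a) (X n))"
    using assms padic_norm.transfer[where 'a = 'a] unfolding cr_padic_eq rel_fun_def by simp
  thus ?thesis
    using padic_Cauchy_abs_convergent[OF prime_card assms]
    by (simp add: convergent_LIMSEQ_iff)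
qed

lemma padic_norm_nonneg: "padic_norm (x :: 'a::prime_card padic) \<ge> 0"
proof (cases x)
  case (abs X)
  show ?thesis
    unfolding abs(2) by (rule LIMSEQ_le_const[OF tendsto_norm_abs_padic[OF abs(1)]]) simp
qed

lemma padic_norm_eq_0_iff: "padic_norm (x :: 'a::prime_card padic) = 0 \<longleftrightarrow> x = 0"
proof (cases x)
  case (abs X)
  have "x = 0 \<longleftrightarrow> padic_null CARD('a) X"
    using abs by (simp add: zero_padic_def abs_padic_eq_iff)
  thus ?thesis
    using tendsto_norm_abs_padic[OF abs(1)] abs(2)
    by (auto simp: padic_null_def dest: LIMSEQ_unique)
qed

lemma padic_norm_minus: "padic_norm (- x :: 'a::prime_card padic) = padic_norm x"
proof (cases x)
  case (abs X)
  show ?thesis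
    using tendsto_norm_abs_padic[OF padic_Cauchy_minus[OF abs(1)]] tendsto_norm_abs_padic[OF abs(1)]
      abs by (auto simp: abs_padic_minus dest: LIMSEQ_unique)
qed

lemma padic_norm_add_le_max: "padic_norm (x + y :: 'a::prime_card padic) \<le> max (padic_norm x) (padic_norm y)"
proof (cases x; cases y)
  fix X Y assume X: "padic_Cauchy CARD('a) X" "x = abs_padic X"
    and Y: "padic_Cauchy CARD('a) Y" "y = abs_padic Y"
  have "(\<lambda>n. padic_abs CARD('a) (X n + Y n)) \<longlonglongrightarrow> padic_norm (x + y)"
    using X Y tendsto_norm_abs_padic[OF padic_Cauchy_add[OF prime_card X(1) Y(1)]]
    by (simp add: abs_padic_add)
  moreover have "(\<lambda>n. max (padic_abs CARD('a) (X n)) (padic_abs CARD('a) (Y n)))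
                   \<longlonglongrightarrow> max (padic_norm x) (padic_norm y)"
    using tendsto_max[OF tendsto_norm_abs_padic[OF X(1)] tendsto_norm_abs_padic[OF Y(1)]] X(2) Y(2)
    by simp
  ultimately show ?thesis
    by (rule LIMSEQ_le) (simp add: padic_abs_add_le_max)
qed

lemma padic_norm_mult: "padic_norm (x * y :: 'a::prime_card padic) = padic_norm x * padic_norm y"
proof (cases x; cases y)
  fix X Y assume X: "padic_Cauchy CARD('a) X" "x = abs_padic X"
    and Y: "padic_Cauchy CARD('a) Y" "y = abs_padic Y"
  have "(\<lambda>n. padic_abs CARD('a) (X n * Y n)) \<longlonglongrightarrow> padic_norm (x * y)"
    using X Y tendsto_norm_abs_padic[OF padic_Cauchy_mult[OF prime_card X(1) Y(1)]]
    by (simp add: abs_padic_mult)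
  moreover have "(\<lambda>n. padic_abs CARD('a) (X n * Y n)) \<longlonglongrightarrow> padic_norm x * padic_norm y"
    using tendsto_mult[OF tendsto_norm_abs_padic[OF X(1)] tendsto_norm_abs_padic[OF Y(1)]] X Y
    by (simp add: padic_abs_mult)
  ultimately show ?thesis by (rule LIMSEQ_unique)
qed

instantiation padic :: (prime_card) metric_space
begin

definition dist_padic :: "'a padic \<Rightarrow> 'a padic \<Rightarrow> real" where
  "dist_padic x y = padic_norm (x - y)"

definition uniformity_padic :: "('a padic \<times> 'a padic) filter" where
  "uniformity_padic = (INF e\<in>{0<..}. principal {(x, y). dist x y < e})"

definition open_padic :: "'a padic set \<Rightarrow> bool" where
  "open_padic U \<longleftrightarrow> (\<forall>x\<in>U. \<forall>\<^sub>F (x', y) in uniformity. x' = x \<longrightarrow> y \<in> U)"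

instance
proof
  fix x y z :: "'a padic"
  show "uniformity = (INF e\<in>{0<..}. principal {(x :: 'a padic, y). dist x y < e})"
    by (rule uniformity_padic_def)
  show "open U \<longleftrightarrow> (\<forall>x\<in>U. \<forall>\<^sub>F (x', y) in uniformity. x' = x \<longrightarrow> y \<in> U)" for U :: "'a padic set"
    by (rule open_padic_def)
  show "dist x y = 0 \<longleftrightarrow> x = y"
    by (simp add: dist_padic_def padic_norm_eq_0_iff)
  show "dist x y \<le> dist x z + dist y z"
    using padic_norm_add_le_max[of "x - z" "- (y - z)"] padic_norm_nonneg[of "x - z"]
      padic_norm_nonneg[of "y - z"]
    unfolding dist_padic_def padic_norm_minus by (simp add: algebra_simps)
qed

end

lemma norm_of_rat_padic: "padic_norm (of_rat r :: 'p::prime_card padic) = padic_abs CARD('p) r"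
  using tendsto_norm_abs_padic[of "\<lambda>_. r", where 'a = 'p]
  by (simp add: of_rat_padic LIMSEQ_const_iff)

definition padic_integers :: "'p::prime_card padic set" where
  "padic_integers = {x. padic_norm x \<le> 1}"

lemma of_int_in_padic_integers [simp]: "(of_int a :: 'p::prime_card padic) \<in> padic_integers"
  using norm_of_rat_padic[of "of_int a", where 'p = 'p] padic_abs_of_int_le_1[of "CARD('p)" a]
  by (simp add: padic_integers_def)

text \<open>``Linear'' is meant in the affine sense: a translation part is allowed.\<close>

definition padic_linear :: "('p::prime_card padic \<Rightarrow> 'p padic) \<Rightarrow> bool" where
  "padic_linear L \<longleftrightarrow> (\<exists>c a. c \<noteq> 0 \<and> L = (\<lambda>x. c * x + a))"


section \<open>Self-similar sets\<close>

definition is_attractor :: "('a::topological_space \<Rightarrow> 'a) set \<Rightarrow> 'a set \<Rightarrow> bool" where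
  "is_attractor \<G> K \<longleftrightarrow>
     (compact K \<and> K \<noteq> {} \<and> K = (\<Union>G\<in>\<G>. G ` K)) \<and>
     (\<forall>K'. compact K' \<and> K' \<noteq> {} \<and> K' = (\<Union>G\<in>\<G>. G ` K') \<longrightarrow> K' = K)"


section \<open>Hausdorff dimension\<close>

text \<open>
  The term \<open>(diam U)\<^sup>s\<close> of a cover, with the usual conventions \<open>0\<^sup>0 = 1\<close> for nonempty \<open>U\<close> and
  value \<open>0\<close> for empty \<open>U\<close>; recall that \<open>0 powr 0 = 0\<close> in the library.
\<close>

definition diam_power :: "real \<Rightarrow> 'a::metric_space set \<Rightarrow> ennreal" where
  "diam_power s U = (if U = {} then 0 else if s = 0 then 1 else ennreal (diameter U powr s))"

text \<open>
  The boundedness condition matters since \<^const>\<open>diameter\<close> has a junk value on unbounded sets.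
\<close>

definition hausdorff_premeasure :: "real \<Rightarrow> real \<Rightarrow> 'a::metric_space set \<Rightarrow> ennreal" where
  "hausdorff_premeasure \<delta> s A =
     (INF U \<in> {U :: nat \<Rightarrow> 'a set. A \<subseteq> (\<Union>i. U i) \<and> (\<forall>i. bounded (U i) \<and> diameter (U i) \<le> \<delta>)}.
        \<Sum>i. diam_power s (U i))"

definition hausdorff_measure :: "real \<Rightarrow> 'a::metric_space set \<Rightarrow> ennreal" where
  "hausdorff_measure s A = (SUP \<delta>\<in>{0<..}. hausdorff_premeasure \<delta> s A)"

definition hausdorff_dim :: "'a::metric_space set \<Rightarrow> ennreal" where
  "hausdorff_dim A = (INF s \<in> {s. s \<ge> 0 \<and> hausdorff_measure s A = 0}. ennreal s)"

end

theory Submission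
  imports Defs
begin

text \<open>
  Conjugating with \<open>L x = N * x + a\<close> moves the fixed point \<open>d\<^sub>i / (1 - r\<^sub>i)\<close> of
  \<open>x \<mapsto> r\<^sub>i * x + d\<^sub>i\<close> to \<open>e\<^sub>i = N * d\<^sub>i / (1 - r\<^sub>i) + a\<close>, and the new translation part is
  \<open>(1 - r\<^sub>i) * e\<^sub>i\<close>. As \<open>1 - r\<^sub>i\<close> is negative for \<open>r\<^sub>i = p ^ k\<^sub>i\<close> and positive for
  \<open>r\<^sub>i = - p ^ k\<^sub>i\<close>, both sign conditions say that \<open>e\<^sub>i \<le> 0\<close>. So one takes for \<open>N\<close> a common
  denominator of the fixed points, and for \<open>- a\<close> the largest of the integers
  \<open>N * d\<^sub>i / (1 - r\<^sub>i)\<close>.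
\<close>

section \<open>Clearing denominators of finitely many rationals\<close>

lemma finite_common_denominator:
  fixes x :: "'a \<Rightarrow> rat"
  assumes "finite I"
  obtains N :: int where "N > 0" "\<And>i. i \<in> I \<Longrightarrow> of_int N * x i \<in> \<int>"
proof -
  have "\<exists>N::int. N > 0 \<and> (\<forall>i\<in>I. of_int N * x i \<in> \<int>)"
    using assms
  proof induction
    case empty
    show ?case by (intro exI[of _ 1]) simp
  next
    case (insert j I)
    then obtain N :: int where N: "N > 0" "\<And>i. i \<in> I \<Longrightarrow> of_int N * x i \<in> \<int>"
      by blast
    obtain a b where ab: "quotient_of (x j) = (a, b)" by fastforce
    have b: "b > 0" and xj: "of_int b * x j = of_int a"
      using quotient_of_denom_pos[OF ab] quotient_of_div[OF ab] by auto
    have "of_int (N * b) * x i \<in> \<int>" if "i \<in> insert j I" for i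
    proof (cases "i = j")
      case True
      have "of_int (N * b) * x j = of_int (N * a)"
        using xj by (simp add: mult.assoc)
      thus ?thesis using True by (metis Ints_of_int)
    next
      case False
      hence "of_int b * (of_int N * x i) \<in> \<int>"
        using that N(2)[of i] by (simp only: Ints_mult Ints_of_int insert_iff simp_thms)
      thus ?thesis by (simp only: of_int_mult mult_ac)
    qed
    with N(1) b show ?case
      by (intro exI[of _ "N * b"]) simp
  qed
  thus ?thesis using that by blast
qed

lemma finite_rat_affine_nonpos_ints:
  fixes x :: "'a \<Rightarrow> rat"
  assumes "finite I" "I \<noteq> {}"
  obtains N :: int and e :: "'a \<Rightarrow> int" and a :: int
  where "N > 0" "\<And>i. i \<in> I \<Longrightarrow> of_int (e i) = of_int N * x i + of_int a"
    "\<And>i. i \<in> I \<Longrightarrow> e i \<le> 0" "\<exists>i\<in>I. e i = 0"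
proof -
  obtain N :: int where N: "N > 0" "\<And>i. i \<in> I \<Longrightarrow> of_int N * x i \<in> \<int>"
    using finite_common_denominator[OF assms(1)] by blast
  \<comment> \<open>For \<open>i\<close> in \<open>I\<close> the product is already an integer; the
    floor only names it as an \<open>int\<close>.\<close>
  define y where "y i = \<lfloor>of_int N * x i\<rfloor>" for i
  have y: "of_int (y i) = of_int N * x i" if "i \<in> I" for i
    using N(2)[OF that] by (auto simp: y_def elim: Ints_cases)
  have "Max (y ` I) \<in> y ` I"
    using assms by (intro Max_in) auto
  hence "\<exists>i\<in>I. y i - Max (y ` I) = 0"
    by auto
  thus ?thesis
    using that[of N "\<lambda>i. y i - Max (y ` I)" "- Max (y ` I)"] assms(1) N(1)
    by (simp add: y del: minus_Max_eq_Min)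
qed

section \<open>Attractors under conjugation\<close>

lemma is_attractor_conjugate:
  fixes L :: "'a::topological_space \<Rightarrow> 'b::topological_space"
  assumes "homeomorphism UNIV UNIV L M" "is_attractor \<G> K"
  shows "is_attractor ((\<lambda>G. L \<circ> G \<circ> M) ` \<G>) (L ` K)"
proof -
  have L: "continuous_on S L" and M: "continuous_on T M" for S T
    using assms(1) by (auto simp: homeomorphism_def intro: continuous_on_subset)
  have M_L [simp]: "M (L x) = x" and L_M [simp]: "L (M y) = y" for x y
    using assms(1) by (auto simp: homeomorphism_def)
  have K: "compact K" "K \<noteq> {}" "K = (\<Union>G\<in>\<G>. G ` K)"
    and unique: "\<And>K'. compact K' \<Longrightarrow> K' \<noteq> {} \<Longrightarrow> K' = (\<Union>G\<in>\<G>. G ` K') \<Longrightarrow> K' = K"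
    using assms(2) unfolding is_attractor_def by blast+
  have "L ` K = L ` (\<Union>G\<in>\<G>. G ` K)"
    using K(3) by simp
  also have "\<dots> = (\<Union>G\<in>(\<lambda>G. L \<circ> G \<circ> M) ` \<G>. G ` L ` K)"
    by (simp add: image_UN image_image)
  finally have invariant: "L ` K = (\<Union>G\<in>(\<lambda>G. L \<circ> G \<circ> M) ` \<G>. G ` L ` K)" .
  have "K' = L ` K"
    if K': "compact K'" "K' \<noteq> {}" "K' = (\<Union>G\<in>(\<lambda>G. L \<circ> G \<circ> M) ` \<G>. G ` K')" for K'
  proof -
    have "M ` K' = M ` (\<Union>G\<in>(\<lambda>G. L \<circ> G \<circ> M) ` \<G>. G ` K')"
      using K'(3) by simp
    also have "\<dots> = (\<Union>G\<in>\<G>. G ` M ` K')"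
      by (simp add: image_UN image_image)
    finally have "M ` K' = K"
      using K'(1,2) M by (intro unique compact_continuous_image) auto
    thus ?thesis
      by (auto simp: image_image simp flip: \<open>M ` K' = K\<close>)
  qed
  moreover have "compact (L ` K)"
    using L K(1) by (rule compact_continuous_image)
  ultimately show ?thesis
    unfolding is_attractor_def using K(2) invariant by blast
qed

section \<open>Hausdorff dimension under Lipschitz maps\<close>

lemma lipschitz_on_image_bounded_diameter:
  assumes "C-lipschitz_on S f" "bounded S"
  shows "bounded (f ` S)" "diameter (f ` S) \<le> C * diameter S"
proof -
  have C: "C \<ge> 0" using assms(1) by (rule lipschitz_on_nonneg)
  have le: "dist (f x) (f y) \<le> C * diameter S" if "x \<in> S" "y \<in> S" for x y
    using lipschitz_onD[OF assms(1) that] diameter_bounded_bound[OF assms(2) that] C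
    by (meson mult_left_mono order_trans)
  thus "bounded (f ` S)"
    unfolding bounded_two_points by blast
  show "diameter (f ` S) \<le> C * diameter S"
  proof (cases "S = {}")
    case False
    thus ?thesis
      using le by (auto simp: diameter_def intro!: cSUP_least)
  qed simp
qed

text \<open>The convention at exponent 0 shapes the premises: there a non-empty \<open>T\<close>
  counts 1, so \<open>S\<close> must be non-empty as well, and \<open>C powr 0\<close> is 1 only for
  \<open>C\<close> different from 0.\<close>

lemma diam_power_mono:
  assumes "s \<ge> 0" "C > 0" "S = {} \<Longrightarrow> T = {}" "bounded S" "bounded T"
    "diameter T \<le> C * diameter S"
  shows "diam_power s T \<le> ennreal (C powr s) * diam_power s S"
proof (cases "T = {} \<or> s = 0")
  case True
  thus ?thesis using assms(2,3) by (auto simp: diam_power_def)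
next
  case False
  have "diameter T powr s \<le> (C * diameter S) powr s"
    using assms by (intro powr_mono2 diameter_ge_0) auto
  also have "\<dots> = C powr s * diameter S powr s"
    using assms by (intro powr_mult)
  finally show ?thesis
    using False assms(3) by (auto simp: diam_power_def ennreal_leI simp flip: ennreal_mult)
qed

lemma hausdorff_premeasure_lipschitz_image:
  assumes "C-lipschitz_on A f" "C > 0" "s \<ge> 0"
  shows "hausdorff_premeasure (C * \<delta>) s (f ` A) \<le> ennreal (C powr s) * hausdorff_premeasure \<delta> s A"
proof -
  have "hausdorff_premeasure (C * \<delta>) s (f ` A) \<le> ennreal (C powr s) * (\<Sum>i. diam_power s (U i))"
    if U: "A \<subseteq> (\<Union>i. U i)" "\<And>i. bounded (U i)" "\<And>i. diameter (U i) \<le> \<delta>" for U :: "nat \<Rightarrow> 'a set"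
  proof -
    \<comment> \<open>The cover may leave \<open>A\<close>, but \<open>f\<close> is Lipschitz only
      on \<open>A\<close>.\<close>
    define V where "V i = f ` (A \<inter> U i)" for i
    have lip: "C-lipschitz_on (A \<inter> U i) f" for i
      using assms(1) by (rule lipschitz_on_subset) simp
    have bdd: "bounded (A \<inter> U i)" for i
      using U(2) by (simp add: bounded_Int)
    have V: "bounded (V i)" "diameter (V i) \<le> C * diameter (U i)" for i
    proof -
      show "bounded (V i)"
        unfolding V_def by (rule lipschitz_on_image_bounded_diameter[OF lip bdd])
      have "diameter (V i) \<le> C * diameter (A \<inter> U i)"
        unfolding V_def by (rule lipschitz_on_image_bounded_diameter[OF lip bdd])
      also have "\<dots> \<le> C * diameter (U i)"
        using assms(2) U(2) by (intro mult_left_mono diameter_subset) auto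
      finally show "diameter (V i) \<le> C * diameter (U i)" .
    qed
    have "diameter (V i) \<le> C * \<delta>" for i
      using V(2)[of i] U(3)[of i] assms(2) by (meson less_imp_le mult_left_mono order_trans)
    moreover have "f ` A \<subseteq> (\<Union>i. V i)"
      using U(1) by (fastforce simp: V_def)
    ultimately have "hausdorff_premeasure (C * \<delta>) s (f ` A) \<le> (\<Sum>i. diam_power s (V i))"
      unfolding hausdorff_premeasure_def using V(1) by (intro INF_lower) auto
    also have "\<dots> \<le> (\<Sum>i. ennreal (C powr s) * diam_power s (U i))"
      using V U(2) assms(2,3) by (intro suminf_le diam_power_mono) (auto simp: V_def)
    finally show ?thesis by simp
  qed
  \<comment> \<open>Dividing by the positive finite constant isolates the infimum over covers on the
    right; multiplying back then gives the claim.\<close>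
  hence "hausdorff_premeasure (C * \<delta>) s (f ` A) / ennreal (C powr s) \<le> hausdorff_premeasure \<delta> s A"
    unfolding hausdorff_premeasure_def[of \<delta>] using assms(2)
    by (intro INF_greatest divide_le_posI_ennreal) (auto simp: mult.commute)
  hence "hausdorff_premeasure (C * \<delta>) s (f ` A) / ennreal (C powr s) * ennreal (C powr s)
           \<le> hausdorff_premeasure \<delta> s A * ennreal (C powr s)"
    by (rule mult_right_mono) simp
  thus ?thesis
    using assms(2) by (simp add: ennreal_divide_times mult.commute[of _ "hausdorff_premeasure \<delta> s A"])
qed

text \<open>The measure is a supremum over scales, so a null set has premeasure 0 at every scale.
  Scale \<open>\<delta> / D\<close> for \<open>A\<close> controls scale \<open>\<delta>\<close> for
  the image.\<close>

lemma hausdorff_measure_lipschitz_image_eq_0: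
  assumes "C-lipschitz_on A f" "s \<ge> 0" "hausdorff_measure s A = 0"
  shows "hausdorff_measure s (f ` A) = 0"
proof -
  \<comment> \<open>\<open>C\<close> may be 0, whereas the premeasure bound asks for a positive
    constant.\<close>
  define D where "D = max C 1"
  have D: "D > 0" and lip: "D-lipschitz_on A f"
    using assms(1) by (auto simp: D_def intro: lipschitz_on_le)
  have "hausdorff_premeasure \<delta> s (f ` A) = 0" if "\<delta> > 0" for \<delta>
  proof -
    have "hausdorff_premeasure (\<delta> / D) s A \<le> hausdorff_measure s A"
      unfolding hausdorff_measure_def using that D by (intro SUP_upper) simp
    hence "hausdorff_premeasure (\<delta> / D) s A = 0"
      using assms(3) by simp
    thus ?thesis
      using hausdorff_premeasure_lipschitz_image[OF lip D assms(2), of "\<delta> / D"] D by simp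
  qed
  thus ?thesis
    unfolding hausdorff_measure_def by (simp add: SUP_eq_const)
qed

lemma hausdorff_dim_lipschitz_image_le:
  assumes "C-lipschitz_on A f"
  shows "hausdorff_dim (f ` A) \<le> hausdorff_dim A"
  unfolding hausdorff_dim_def
  using hausdorff_measure_lipschitz_image_eq_0[OF assms] by (intro INF_superset_mono) auto

lemma hausdorff_dim_bilipschitz_image:
  assumes "C-lipschitz_on A f" "D-lipschitz_on (f ` A) g" "\<And>x. x \<in> A \<Longrightarrow> g (f x) = x"
  shows "hausdorff_dim (f ` A) = hausdorff_dim A"
  using hausdorff_dim_lipschitz_image_le[OF assms(1)] hausdorff_dim_lipschitz_image_le[OF assms(2)]
    assms(3) by (simp add: image_image)

section \<open>Affine maps of p-adic numbers and the normal form\<close>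

lemma lipschitz_on_padic_affine:
  "(padic_norm c)-lipschitz_on A (\<lambda>x. c * x + a :: 'p::prime_card padic)"
proof (rule lipschitz_onI)
  fix x y :: "'p padic"
  have "c * x + a - (c * y + a) = c * (x - y)"
    by (simp add: algebra_simps)
  thus "dist (c * x + a) (c * y + a) \<le> padic_norm c * dist x y"
    by (simp add: dist_padic_def padic_norm_mult)
qed (rule padic_norm_nonneg)

theorem theorem3p6:
  fixes F :: "nat \<Rightarrow> 'p::prime_card padic \<Rightarrow> 'p padic"
    and d :: "nat \<Rightarrow> 'p padic"
    and b k :: "nat \<Rightarrow> nat"
    and p n :: nat
    and K :: "'p padic set"
  assumes "p = CARD('p)"
    and "n \<ge> 1"
    and "\<And>i. i \<in> {1..n} \<Longrightarrow> b i \<in> {0, 1}"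
    and "\<And>i. i \<in> {1..n} \<Longrightarrow> k i \<ge> 1"
    and "\<And>i. i \<in> {1..n} \<Longrightarrow> d i \<in> padic_integers \<inter> \<rat>"
    and "\<And>i. i \<in> {1..n} \<Longrightarrow> F i = (\<lambda>x. (-1) ^ b i * of_nat p ^ k i * x + d i)"
    and "is_attractor (F ` {1..n}) K"
  shows "\<exists>(L :: 'p padic \<Rightarrow> 'p padic) (d' :: nat \<Rightarrow> int).
           padic_linear L \<and>
           (\<forall>i\<in>{1..n}. \<forall>x. (L \<circ> F i \<circ> inv L) x = (-1) ^ b i * of_nat p ^ k i * x + of_int (d' i)) \<and>
           (\<forall>i\<in>{1..n}. (of_int (d' i) :: 'p padic) \<in> padic_integers) \<and>
           (\<forall>i\<in>{1..n}. (b i = 0 \<longrightarrow> d' i \<ge> 0) \<and> (b i = 1 \<longrightarrow> d' i \<le> 0)) \<and>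
           (\<exists>i\<in>{1..n}. d' i = 0) \<and>
           is_attractor ((\<lambda>i. L \<circ> F i \<circ> inv L) ` {1..n}) (L ` K) \<and>
           hausdorff_dim K = hausdorff_dim (L ` K)"
proof -
  \<comment> \<open>The coefficients are taken as integers, so that signs and \<open>1 - r i\<close>
    make sense outside the p-adic field.\<close>
  define r where "r i = (-1) ^ b i * int p ^ k i" for i
  have r_b0: "r i > 1" if "i \<in> {1..n}" "b i = 0" for i
    using that assms(1,4) prime_gt_1_nat[OF prime_card[where 'a = 'p]]
    by (auto simp: r_def Suc_le_eq intro!: one_less_power)
  have r_b1: "r i < 0" if "i \<in> {1..n}" "b i = 1" for i
    using that assms(1) prime_gt_0_nat[OF prime_card[where 'a = 'p]]
    by (simp add: r_def)
  \<comment> \<open>Hence the fixed points \<open>q i / of_int (1 - r i)\<close> are genuine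
    quotients, not the default value of division by 0.\<close>
  have r_neq: "r i \<noteq> 1" if "i \<in> {1..n}" for i
    using that r_b0[OF that] r_b1[OF that] assms(3)[OF that] by auto
  have F: "F i x = of_int (r i) * x + d i" if "i \<in> {1..n}" for i x
    using assms(6)[OF that] by (simp add: r_def)
  have "\<forall>i\<in>{1..n}. \<exists>q. d i = of_rat q"
    using assms(5) by (metis IntD2 Rats_cases)
  then obtain q where q: "\<And>i. i \<in> {1..n} \<Longrightarrow> d i = of_rat (q i)"
    by metis
  have "finite {1..n}" "{1..n} \<noteq> {}"
    using assms(2) by auto
  then obtain N :: int and e :: "nat \<Rightarrow> int" and a :: int where N: "N > 0"
    and e: "\<And>i. i \<in> {1..n} \<Longrightarrow> of_int (e i) = of_int N * (q i / of_int (1 - r i)) + of_int a"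
    and e_le: "\<And>i. i \<in> {1..n} \<Longrightarrow> e i \<le> 0" and e_0: "\<exists>i\<in>{1..n}. e i = 0"
    by (rule finite_rat_affine_nonpos_ints[where x = "\<lambda>i. q i / of_int (1 - r i)"]) blast
  define d' where "d' i = (1 - r i) * e i" for i
  have d': "of_int (d' i) = of_int N * d i + of_int a * (1 - of_int (r i))"
    if i: "i \<in> {1..n}" for i
  proof -
    have "(1 - of_int (r i) :: rat) \<noteq> 0"
      using r_neq[OF i] by (metis of_int_1 of_int_eq_iff right_minus_eq)
    hence "(of_int (d' i) :: rat) = of_int N * q i + of_int a * (1 - of_int (r i))"
      using e[OF i] by (simp add: d'_def field_simps)
    \<comment> \<open>The identity is proved over the rationals, where \<open>e\<close> lives, and
      carried to the p-adic field by \<open>of_rat\<close>.\<close>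
    hence "(of_rat (of_int (d' i)) :: 'p padic) =
        of_rat (of_int N * q i + of_int a * (1 - of_int (r i)))"
      by simp
    thus ?thesis
      using q[OF i] by (simp add: of_rat_add of_rat_mult of_rat_diff)
  qed
  define L where "L x = of_int N * x + of_int a" for x :: "'p padic"
  \<comment> \<open>The inverse of \<open>L\<close>, written as \<open>c * x + a\<close> so that the
    affine Lipschitz bound applies to it too.\<close>
  define M where "M x = inverse (of_int N) * x + (- (inverse (of_int N) * of_int a))" for x :: "'p padic"
  have N0: "(of_int N :: 'p padic) \<noteq> 0"
    using N by simp
  have L_M [simp]: "L (M x) = x" and M_L [simp]: "M (L x) = x" for x
    using N0 by (simp_all add: L_def M_def field_simps)
  have inv_L: "inv L = M"
    by (rule inv_equality) simp_all
  have lip: "(padic_norm (of_int N :: 'p padic))-lipschitz_on A L"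
    "(padic_norm (inverse (of_int N :: 'p padic)))-lipschitz_on A M" for A
    unfolding L_def M_def by (rule lipschitz_on_padic_affine)+
  \<comment> \<open>The two Lipschitz bounds give continuity both ways here and equality of
    dimensions below.\<close>
  have "homeomorphism UNIV UNIV L M"
    using lip[THEN lipschitz_on_continuous_on] by (intro homeomorphismI) auto
  hence "is_attractor ((\<lambda>G. L \<circ> G \<circ> M) ` F ` {1..n}) (L ` K)"
    using assms(7) by (rule is_attractor_conjugate)
  hence "is_attractor ((\<lambda>i. L \<circ> F i \<circ> inv L) ` {1..n}) (L ` K)"
    by (simp add: image_image inv_L)
  moreover have "(L \<circ> F i \<circ> inv L) x = (-1) ^ b i * of_nat p ^ k i * x + of_int (d' i)"
    if i: "i \<in> {1..n}" for i x
  proof -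
    \<comment> \<open>Keeping the product \<open>of_int N * M x\<close> together avoids computing
      with the inverse of \<open>N\<close>.\<close>
    have "of_int N * M x = x - of_int a"
      using L_M[of x] unfolding L_def by (simp add: algebra_simps)
    have "(L \<circ> F i \<circ> inv L) x = of_int (r i) * (of_int N * M x) + of_int N * d i + of_int a"
      using F[OF i] by (simp add: inv_L L_def algebra_simps)
    also have "\<dots> = of_int (r i) * x + of_int (d' i)"
      unfolding \<open>of_int N * M x = x - of_int a\<close> d'[OF i] by (simp add: algebra_simps)
    finally show ?thesis by (simp add: r_def)
  qed
  moreover have "padic_linear L"
    unfolding padic_linear_def using N0 L_def by blast
  moreover have "(b i = 0 \<longrightarrow> d' i \<ge> 0) \<and> (b i = 1 \<longrightarrow> d' i \<le> 0)" if "i \<in> {1..n}" for i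
    using r_b0[OF that] r_b1[OF that] e_le[OF that]
    by (auto simp: d'_def intro: mult_nonpos_nonpos mult_nonneg_nonpos)
  moreover have "\<exists>i\<in>{1..n}. d' i = 0"
    using e_0 by (auto simp: d'_def)
  moreover have "hausdorff_dim K = hausdorff_dim (L ` K)"
    using hausdorff_dim_bilipschitz_image[OF lip] by simp
  ultimately show ?thesis
    \<comment> \<open>The remaining claim, that the \<open>d' i\<close> are p-adic integers, is the
      simp rule \<open>of_int_in_padic_integers\<close>.\<close>
    by (intro exI[of _ L] exI[of _ d']) simp
qed

end
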